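(* Let $(X,d)$ be a CAT(0) space and let $T_1, T_2 : X \to X$ be mappings satisfying property $(P_2)$. Let $\lambda \in (0,1)$ and let $T:X\to X$ be defined by $Tx:=(1-\lambda)T_1x + \lambda T_2x$ for all $x\in X$. Let $p \in Fix(T)$ and $b > 0$. Define, for any $\varepsilon>0$, $$k_b(\varepsilon):= \left\lceil \frac{2b}{\varepsilon} \right\rceil, \qquad \Phi_b(\varepsilon):=k_b(\varepsilon) \cdot \left\lceil \frac{2b(1+2^{k_b(\varepsilon)})}{\varepsilon} \right\rceil + 1.$$ Then, for any $x \in X$ with $d(x,p) \leq b$, for all $\varepsilon > 0$ and all $n \geq \Phi_b(\varepsilon)$, $d(T^nx, T^{n+1}x) \leq \varepsilon$.
   Context: A geodesic joining $x,y$ in a metric space $(X,d)$ is a map $\gamma:[0,1]\to X$ with $\gamma(0)=x$, $\gamma(1)=y$ and $d(\gamma(t),\gamma(t'))=|t-t'|\,d(x,y)$ for all $t,t'\in[0,1]$; $(X,d)$ is geodesic if any two points are joined by a geodesic. A CAT(0) space is a geodesic space such that for every geodesic $\gamma:[0,1]\to X$, every $z\in X$ and $t\in[0,1]$, $d^2(z,\gamma(t))\le (1-t)d^2(z,\gamma(0))+t\,d^2(z,\gamma(1))-t(1-t)d^2(\gamma(0),\gamma(1))$ (completeness is not assumed). Geodesics in a CAT(0) space are unique, and $(1-t)x+ty$ denotes the point $\gamma(t)$ on the unique geodesic $\gamma$ joining $x$ to $y$. A mapping $T:X\to X$ satisfies property $(P_2)$ if for all $x,y\in X$, $2d^2(Tx,Ty)\le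 d^2(x,Ty)+d^2(y,Tx)-d^2(x,Tx)-d^2(y,Ty)$. $Fix(T)$ denotes the set of fixed points of $T$. *)

theory Defs
  imports "HOL-Analysis.Analysis"
begin

text \<open>Geodesics are functions on all of \<^typ>\<open>real\<close>, of which only the restriction to
  \<open>{0..1}\<close> matters.\<close>

definition (in metric_space) geodesic_joining :: "(real \<Rightarrow> 'a) \<Rightarrow> 'a \<Rightarrow> 'a \<Rightarrow> bool" where
  "geodesic_joining \<gamma> x y \<longleftrightarrow>
     \<gamma> 0 = x \<and> \<gamma> 1 = y \<and>
     (\<forall>t\<in>{0..1}. \<forall>t'\<in>{0..1}. dist (\<gamma> t) (\<gamma> t') = \<bar>t - t'\<bar> * dist x y)"

class geodesic_space = metric_space +
  assumes ex_geodesic: "\<exists>\<gamma>. geodesic_joining \<gamma> x y"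

class cat0_space = geodesic_space +
  assumes cat0_inequality:
    "\<lbrakk>geodesic_joining \<gamma> x y; 0 \<le> t; t \<le> 1\<rbrakk> \<Longrightarrow>
       (dist z (\<gamma> t))\<^sup>2 \<le> (1 - t) * (dist z (\<gamma> 0))\<^sup>2 + t * (dist z (\<gamma> 1))\<^sup>2
                         - t * (1 - t) * (dist (\<gamma> 0) (\<gamma> 1))\<^sup>2"

lemma geodesic_unique:
  fixes x y :: "'a::cat0_space"
  assumes g: "geodesic_joining \<gamma> x y" and h: "geodesic_joining \<gamma>' x y"
    and t: "0 \<le> t" "t \<le> 1"
  shows "\<gamma> t = \<gamma>' t"
proof -
  have ends: "\<gamma> 0 = x" "\<gamma> 1 = y" "\<gamma>' 0 = x" "\<gamma>' 1 = y"
    using g h by (auto simp: geodesic_joining_def)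
  have D: "dist (\<gamma>' s) (\<gamma>' s') = \<bar>s - s'\<bar> * dist x y" if "s \<in> {0..1}" "s' \<in> {0..1}" for s s'
    using h that unfolding geodesic_joining_def by blast
  have d: "dist (\<gamma>' t) x = t * dist x y" "dist (\<gamma>' t) y = (1 - t) * dist x y"
    using D[of t 0] D[of t 1] t by (simp_all add: ends)
  have "(dist (\<gamma>' t) (\<gamma> t))\<^sup>2 \<le> (1 - t) * (t * dist x y)\<^sup>2 + t * ((1 - t) * dist x y)\<^sup>2
                         - t * (1 - t) * (dist x y)\<^sup>2"
    using cat0_inequality[OF g t, of "\<gamma>' t"] by (simp only: ends d)
  also have "\<dots> = 0"
    by (simp add: power2_eq_square algebra_simps)
  finally show ?thesis by simp
qed

text \<open>\<open>geodesic_combination t x y\<close> is the point \<open>(1 - t) x + t y\<close>; it is meaningful for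
  \<open>0 \<le> t \<le> 1\<close>. The point is described rather than the geodesic, since a geodesic is unique
  only on \<open>{0..1}\<close>.\<close>

definition geodesic_combination :: "real \<Rightarrow> 'a::cat0_space \<Rightarrow> 'a \<Rightarrow> 'a" where
  "geodesic_combination t x y = (THE z. \<exists>\<gamma>. geodesic_joining \<gamma> x y \<and> z = \<gamma> t)"

lemma geodesic_combination_eq:
  fixes x y :: "'a::cat0_space"
  assumes "geodesic_joining \<gamma> x y" "0 \<le> t" "t \<le> 1"
  shows "geodesic_combination t x y = \<gamma> t"
  unfolding geodesic_combination_def
proof (rule the_equality)
  show "\<exists>\<gamma>'. geodesic_joining \<gamma>' x y \<and> \<gamma> t = \<gamma>' t"
    using assms(1) by (intro exI[of _ \<gamma>]) simp
next
  fix z assume "\<exists>\<gamma>'. geodesic_joining \<gamma>' x y \<and> z = \<gamma>' t"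
  then obtain \<gamma>' where "geodesic_joining \<gamma>' x y" "z = \<gamma>' t" by (elim exE conjE)
  then show "z = \<gamma> t"
    using geodesic_unique[OF _ assms] by simp
qed

definition property_P2 :: "('a::metric_space \<Rightarrow> 'a) \<Rightarrow> bool" where
  "property_P2 T \<longleftrightarrow>
     (\<forall>x y. 2 * (dist (T x) (T y))\<^sup>2
        \<le> (dist x (T y))\<^sup>2 + (dist y (T x))\<^sup>2 - (dist x (T x))\<^sup>2 - (dist y (T y))\<^sup>2)"

definition Fix :: "('a \<Rightarrow> 'a) \<Rightarrow> 'a set" where
  "Fix T = {x. T x = x}"

text \<open>The truncation \<^const>\<open>nat\<close> is harmless: the ceilings are positive for \<open>b, \<epsilon> > 0\<close>.\<close>

definition k_rate :: "real \<Rightarrow> real \<Rightarrow> nat" where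
  "k_rate b \<epsilon> = nat \<lceil>2 * b / \<epsilon>\<rceil>"

definition Phi_rate :: "real \<Rightarrow> real \<Rightarrow> nat" where
  "Phi_rate b \<epsilon> = k_rate b \<epsilon> * nat \<lceil>2 * b * (1 + 2 ^ k_rate b \<epsilon>) / \<epsilon>\<rceil> + 1"

end

theory Submission
  imports Defs
begin

text \<open>
  Equip \<open>X \<times> X\<close> with the squared distance \<open>(1 - \<lambda>) d\<^sup>2 + \<lambda> d\<^sup>2\<close>; this is again a CAT(0) metric.
  The point \<open>(1 - \<lambda>) a + \<lambda> c\<close> is the projection of \<open>(a, c)\<close> onto the diagonal, so \<open>T\<close> is the
  map \<open>x \<mapsto> (T1 x, T2 x)\<close> followed by that projection, and both of these satisfy \<open>(P\<^sub>2)\<close>. A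
  composition of \<open>(P\<^sub>2)\<close> maps need not satisfy \<open>(P\<^sub>2)\<close>, but adding the two inequalities and
  regrouping the terms with the Cauchy--Schwarz inequality of CAT(0) geometry
  (\<open>quadrilateral_inequality\<close>) leaves two purely metric facts about \<open>T\<close>: it is nonexpansive, and
  \<open>2 d(Tu, Tv) \<le> d(u, Tv) + d(Tu, v)\<close> (\<open>dist_average_le\<close> and \<open>average_midpoint_bound\<close>).

  The rest takes place in an arbitrary metric space. Along an orbit, the second fact is a
  convexity inequality for distances as functions of the separation \<open>k\<close>:
  \<open>d(x\<^sub>n, x\<^sub>n\<^sub>+\<^sub>k\<^sub>+\<^sub>2) \<ge> 2 d(x\<^sub>n\<^sub>+\<^sub>1, x\<^sub>n\<^sub>+\<^sub>k\<^sub>+\<^sub>2) - d(x\<^sub>n\<^sub>+\<^sub>1, x\<^sub>n\<^sub>+\<^sub>k\<^sub>+\<^sub>1)\<close>. Thus if consecutive steps have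
  almost equal length \<open>s\<close>, then \<open>k + 1\<close> of them cover almost the distance \<open>(k + 1) s\<close>
  (\<open>dist_ge_of_steady_steps\<close>). A fixed point confines the orbit to a ball of radius \<open>b\<close>, so
  \<open>(k + 1) s\<close> is at most about \<open>2 b\<close>. Step lengths never increase and are at most \<open>2 b\<close>; among
  sufficiently many blocks of \<open>k\<close> steps there is therefore one in which they hardly change. The
  two ceilings in the rate are the block length and the number of blocks.
\<close>

section \<open>The Cauchy--Schwarz inequality in CAT(0) spaces\<close>

lemma dist_geodesic_combination_le:
  fixes x y z :: "'a::cat0_space"
  assumes "0 \<le> t" "t \<le> 1"
  shows "(dist z (geodesic_combination t x y))\<^sup>2
    \<le> (1 - t) * (dist z x)\<^sup>2 + t * (dist z y)\<^sup>2 - t * (1 - t) * (dist x y)\<^sup>2"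
proof -
  obtain \<gamma> where g: "geodesic_joining \<gamma> x y"
    using ex_geodesic by blast
  then have "\<gamma> 0 = x" "\<gamma> 1 = y"
    by (auto simp: geodesic_joining_def)
  then show ?thesis
    using cat0_inequality[OF g assms, of z] geodesic_combination_eq[OF g assms] by simp
qed

lemma dist_geodesic_combination_ends:
  fixes x y :: "'a::cat0_space"
  assumes "0 \<le> t" "t \<le> 1"
  shows "dist (geodesic_combination t x y) x = t * dist x y"
    and "dist (geodesic_combination t x y) y = (1 - t) * dist x y"
proof -
  obtain \<gamma> where g: "geodesic_joining \<gamma> x y"
    using ex_geodesic by blast
  then have ends: "\<gamma> 0 = x" "\<gamma> 1 = y"
    by (auto simp: geodesic_joining_def)
  have D: "dist (\<gamma> s) (\<gamma> s') = \<bar>s - s'\<bar> * dist x y" if "s \<in> {0..1}" "s' \<in> {0..1}" for s s'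
    using g that unfolding geodesic_joining_def by blast
  show "dist (geodesic_combination t x y) x = t * dist x y"
    "dist (geodesic_combination t x y) y = (1 - t) * dist x y"
    using D[of t 0] D[of t 1] assms ends geodesic_combination_eq[OF g assms] by simp_all
qed

lemma power2_sum_le_weighted:
  fixes u v t :: real
  assumes "0 < t" "t < 1"
  shows "(u + v)\<^sup>2 \<le> u\<^sup>2 / t + v\<^sup>2 / (1 - t)"
proof -
  have "u\<^sup>2 / t + v\<^sup>2 / (1 - t) - (u + v)\<^sup>2 = ((1 - t) * u - t * v)\<^sup>2 / (t * (1 - t))"
    using assms by (simp add: field_simps power2_eq_square)
  also have "\<dots> \<ge> 0"
    using assms by simp
  finally show ?thesis by simp
qed

text \<open>The left-hand side is twice the quasi-inner product of Berg and Nikolaev, which in a Hilbert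
  space is \<open>\<langle>b - a, d - c\<rangle>\<close>. The path from \<open>b\<close> to \<open>c\<close> through a point dividing \<open>[a, d]\<close>
  gives the bound \<open>(1 - t) / t * d(a, b)\<^sup>2 + t / (1 - t) * d(c, d)\<^sup>2\<close>, which is optimal when
  \<open>t / (1 - t) = d(a, b) / d(c, d)\<close>.\<close>

lemma quadrilateral_inequality:
  fixes a b c d :: "'a::cat0_space"
  shows "(dist a d)\<^sup>2 + (dist b c)\<^sup>2 - (dist a c)\<^sup>2 - (dist b d)\<^sup>2 \<le> 2 * dist a b * dist c d"
proof (cases "a = b \<or> c = d")
  case True
  then show ?thesis by auto
next
  case False
  define p q where "p = dist a b" and "q = dist c d"
  have pq: "p > 0" "q > 0"
    using False by (auto simp: p_def q_def)
  define t where "t = p / (p + q)"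
  have t1: "1 - t = q / (p + q)"
    using pq by (simp add: t_def field_simps)
  have t: "0 < t" "t < 1"
    using pq by (simp_all add: t_def)
  define m where "m = geodesic_combination t a d"
  have bm: "(dist b m)\<^sup>2 \<le> (1 - t) * p\<^sup>2 + t * (dist b d)\<^sup>2 - t * (1 - t) * (dist a d)\<^sup>2"
    using dist_geodesic_combination_le[of t b a d] t by (simp add: m_def p_def dist_commute)
  have cm: "(dist c m)\<^sup>2 \<le> (1 - t) * (dist a c)\<^sup>2 + t * q\<^sup>2 - t * (1 - t) * (dist a d)\<^sup>2"
    using dist_geodesic_combination_le[of t c a d] t by (simp add: m_def q_def dist_commute)
  have "dist b c \<le> dist b m + dist c m"
    by (rule dist_triangle2)
  then have "(dist b c)\<^sup>2 \<le> (dist b m + dist c m)\<^sup>2"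
    by (intro power_mono) auto
  also have "\<dots> \<le> (dist b m)\<^sup>2 / t + (dist c m)\<^sup>2 / (1 - t)"
    using t by (rule power2_sum_le_weighted)
  also have "\<dots> \<le> ((1 - t) * p\<^sup>2 + t * (dist b d)\<^sup>2 - t * (1 - t) * (dist a d)\<^sup>2) / t
      + ((1 - t) * (dist a c)\<^sup>2 + t * q\<^sup>2 - t * (1 - t) * (dist a d)\<^sup>2) / (1 - t)"
    using t bm cm by (intro add_mono divide_right_mono) auto
  also have "\<dots> = (1 - t) / t * p\<^sup>2 + t / (1 - t) * q\<^sup>2
      + (dist b d)\<^sup>2 + (dist a c)\<^sup>2 - (dist a d)\<^sup>2"
    using t by (simp add: field_simps)
  also have "(1 - t) / t * p\<^sup>2 + t / (1 - t) * q\<^sup>2 = 2 * p * q"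
  proof -
    have "(1 - t) / t = q / p" "t / (1 - t) = p / q"
      using pq unfolding t1 by (simp_all add: t_def)
    then show ?thesis
      using pq by (simp add: power2_eq_square)
  qed
  finally show ?thesis
    by (simp add: p_def q_def)
qed

section \<open>Pairs of points and the projection onto the diagonal\<close>

definition pair_dist :: "real \<Rightarrow> 'a::metric_space \<times> 'a \<Rightarrow> 'a \<times> 'a \<Rightarrow> real" where
  "pair_dist lam y z =
     sqrt ((1 - lam) * (dist (fst y) (fst z))\<^sup>2 + lam * (dist (snd y) (snd z))\<^sup>2)"

lemma pair_dist_nonneg:
  "0 \<le> lam \<Longrightarrow> lam \<le> 1 \<Longrightarrow> 0 \<le> pair_dist lam y z"
  by (simp add: pair_dist_def)

lemma pair_dist_commute: "pair_dist lam y z = pair_dist lam z y"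
  by (simp add: pair_dist_def dist_commute)

lemma pair_dist_power2:
  assumes "0 \<le> lam" "lam \<le> 1"
  shows "(pair_dist lam y z)\<^sup>2 =
    (1 - lam) * (dist (fst y) (fst z))\<^sup>2 + lam * (dist (snd y) (snd z))\<^sup>2"
  using assms by (simp add: pair_dist_def)

lemma pair_dist_diagonal: "pair_dist lam (u, u) (v, v) = dist u v"
  by (simp add: pair_dist_def algebra_simps)

lemma weighted_Cauchy_Schwarz:
  fixes p q r s w w' :: real
  assumes "0 \<le> w" "0 \<le> w'"
  shows "w * p * r + w' * q * s \<le> sqrt (w * p\<^sup>2 + w' * q\<^sup>2) * sqrt (w * r\<^sup>2 + w' * s\<^sup>2)"
proof -
  have "(w * p\<^sup>2 + w' * q\<^sup>2) * (w * r\<^sup>2 + w' * s\<^sup>2) - (w * p * r + w' * q * s)\<^sup>2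
      = w * w' * (p * s - q * r)\<^sup>2"
    by (simp add: power2_eq_square algebra_simps)
  also have "\<dots> \<ge> 0"
    using assms by simp
  finally have "(w * p * r + w' * q * s)\<^sup>2 \<le> (w * p\<^sup>2 + w' * q\<^sup>2) * (w * r\<^sup>2 + w' * s\<^sup>2)"
    by simp
  then show ?thesis
    unfolding real_sqrt_mult[symmetric] by (rule real_le_rsqrt)
qed

lemma pair_quadrilateral_inequality:
  fixes a b c d :: "'a::cat0_space \<times> 'a"
  assumes "0 \<le> lam" "lam \<le> 1"
  shows "(pair_dist lam a d)\<^sup>2 + (pair_dist lam b c)\<^sup>2 - (pair_dist lam a c)\<^sup>2
      - (pair_dist lam b d)\<^sup>2 \<le> 2 * pair_dist lam a b * pair_dist lam c d"
proof -
  have "(pair_dist lam a d)\<^sup>2 + (pair_dist lam b c)\<^sup>2 - (pair_dist lam a c)\<^sup>2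
      - (pair_dist lam b d)\<^sup>2
    = (1 - lam) * ((dist (fst a) (fst d))\<^sup>2 + (dist (fst b) (fst c))\<^sup>2
        - (dist (fst a) (fst c))\<^sup>2 - (dist (fst b) (fst d))\<^sup>2)
      + lam * ((dist (snd a) (snd d))\<^sup>2 + (dist (snd b) (snd c))\<^sup>2
        - (dist (snd a) (snd c))\<^sup>2 - (dist (snd b) (snd d))\<^sup>2)"
    unfolding pair_dist_power2[OF assms] by (simp add: algebra_simps)
  also have "\<dots> \<le> (1 - lam) * (2 * dist (fst a) (fst b) * dist (fst c) (fst d))
      + lam * (2 * dist (snd a) (snd b) * dist (snd c) (snd d))"
    using assms by (intro add_mono mult_left_mono quadrilateral_inequality) auto
  also have "\<dots> = 2 * ((1 - lam) * dist (fst a) (fst b) * dist (fst c) (fst d)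
      + lam * dist (snd a) (snd b) * dist (snd c) (snd d))"
    by (simp add: algebra_simps)
  also have "\<dots> \<le> 2 * (pair_dist lam a b * pair_dist lam c d)"
    unfolding pair_dist_def using assms
    by (intro mult_left_mono weighted_Cauchy_Schwarz) auto
  finally show ?thesis
    by simp
qed

lemma pair_map_P2:
  assumes lam: "0 \<le> lam" "lam \<le> 1" and P2: "property_P2 T1" "property_P2 T2"
  defines "S \<equiv> \<lambda>x. (T1 x, T2 x)"
  shows "2 * (pair_dist lam (S u) (S v))\<^sup>2
    \<le> (pair_dist lam (u, u) (S v))\<^sup>2 + (pair_dist lam (v, v) (S u))\<^sup>2
      - (pair_dist lam (u, u) (S u))\<^sup>2 - (pair_dist lam (v, v) (S v))\<^sup>2"
proof -
  have "(1 - lam) * (2 * (dist (T1 u) (T1 v))\<^sup>2) + lam * (2 * (dist (T2 u) (T2 v))\<^sup>2)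
    \<le> (1 - lam) * ((dist u (T1 v))\<^sup>2 + (dist v (T1 u))\<^sup>2 - (dist u (T1 u))\<^sup>2 - (dist v (T1 v))\<^sup>2)
      + lam * ((dist u (T2 v))\<^sup>2 + (dist v (T2 u))\<^sup>2 - (dist u (T2 u))\<^sup>2 - (dist v (T2 v))\<^sup>2)"
    using lam P2 unfolding property_P2_def by (intro add_mono mult_left_mono) auto
  then show ?thesis
    unfolding pair_dist_power2[OF lam] S_def by (simp add: algebra_simps)
qed

text \<open>The obtuse-angle inequality for the nearest point on the diagonal, which for \<open>y = (a, c)\<close> is
  the point \<open>(1 - \<lambda>) a + \<lambda> c\<close>: its squared distance \<open>\<lambda> (1 - \<lambda>) d(a, c)\<^sup>2\<close> from \<open>y\<close> is exactly the
  correction term in the CAT(0) inequality.\<close>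

lemma pair_dist_diagonal_projection:
  fixes y :: "'a::cat0_space \<times> 'a"
  assumes lam: "0 \<le> lam" "lam \<le> 1"
  defines "m \<equiv> geodesic_combination lam (fst y) (snd y)"
  shows "(pair_dist lam (m, m) y)\<^sup>2 + (dist z m)\<^sup>2 \<le> (pair_dist lam (z, z) y)\<^sup>2"
proof -
  have "(pair_dist lam (m, m) y)\<^sup>2 = lam * (1 - lam) * (dist (fst y) (snd y))\<^sup>2"
    unfolding pair_dist_power2[OF lam] m_def
    by (simp add: dist_geodesic_combination_ends[OF lam] power2_eq_square algebra_simps)
  then show ?thesis
    using dist_geodesic_combination_le[OF lam, of z "fst y" "snd y"]
    unfolding pair_dist_power2[OF lam] m_def by simp
qed

lemma projection_P2:
  fixes y z :: "'a::cat0_space \<times> 'a"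
  assumes lam: "0 \<le> lam" "lam \<le> 1"
  defines "Q \<equiv> \<lambda>y. geodesic_combination lam (fst y) (snd y)"
  shows "2 * (dist (Q y) (Q z))\<^sup>2
    \<le> (pair_dist lam (Q y, Q y) z)\<^sup>2 + (pair_dist lam (Q z, Q z) y)\<^sup>2
      - (pair_dist lam (Q y, Q y) y)\<^sup>2 - (pair_dist lam (Q z, Q z) z)\<^sup>2"
  using pair_dist_diagonal_projection[OF lam, of y "Q z"]
    pair_dist_diagonal_projection[OF lam, of z "Q y"]
  by (simp add: Q_def dist_commute)

section \<open>Two metric properties of averages\<close>

text \<open>Both the pair map and the projection are nonexpansive, as the Cauchy--Schwarz inequality bounds the
  right-hand side of its \<open>(P\<^sub>2)\<close> inequality by twice the product of the distances of the arguments
  and of the images.\<close>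

lemma dist_average_le:
  fixes T1 T2 :: "'a::cat0_space \<Rightarrow> 'a"
  assumes P2: "property_P2 T1" "property_P2 T2" and lam: "0 \<le> lam" "lam \<le> 1"
    and T: "\<And>x. T x = geodesic_combination lam (T1 x) (T2 x)"
  shows "dist (T u) (T v) \<le> pair_dist lam (T1 u, T2 u) (T1 v, T2 v)"
    and "pair_dist lam (T1 u, T2 u) (T1 v, T2 v) \<le> dist u v"
proof -
  define \<beta> where "\<beta> = pair_dist lam (T1 u, T2 u) (T1 v, T2 v)"
  have \<beta>0: "0 \<le> \<beta>"
    using lam by (simp add: \<beta>_def pair_dist_nonneg)
  have "2 * (dist (T u) (T v))\<^sup>2 \<le> 2 * dist (T u) (T v) * \<beta>"
    using projection_P2[OF lam, of "(T1 u, T2 u)" "(T1 v, T2 v)"]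
      pair_quadrilateral_inequality[OF lam, of "(T u, T u)" "(T1 v, T2 v)" "(T v, T v)" "(T1 u, T2 u)"]
    by (simp add: T[symmetric] pair_dist_diagonal \<beta>_def pair_dist_commute)
  then show "dist (T u) (T v) \<le> \<beta>"
    using \<beta>0 by (cases "T u = T v") (auto simp: power2_eq_square)
  have "2 * \<beta>\<^sup>2 \<le> 2 * dist u v * \<beta>"
    using pair_map_P2[OF lam P2, of u v]
      pair_quadrilateral_inequality[OF lam, of "(u, u)" "(T1 v, T2 v)" "(v, v)" "(T1 u, T2 u)"]
    by (simp add: pair_dist_diagonal \<beta>_def pair_dist_commute)
  then show "\<beta> \<le> dist u v"
    using \<beta>0 by (cases "\<beta> = 0") (auto simp: power2_eq_square)
qed

text \<open>The sum of the two \<open>(P\<^sub>2)\<close> inequalities bounds \<open>\<beta>\<^sup>2 + d(Tu, Tv)\<^sup>2\<close>, where \<open>\<beta>\<close> is the distance of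
  the intermediate pairs. Its right-hand side can be regrouped so that Cauchy--Schwarz compares the
  segment between these pairs with the crossed segments \<open>[u, Tv]\<close> and \<open>[Tu, v]\<close>. The unknown \<open>\<beta>\<close>
  then disappears by the inequality of arithmetic and geometric means.\<close>

lemma average_midpoint_bound:
  fixes T1 T2 :: "'a::cat0_space \<Rightarrow> 'a"
  assumes P2: "property_P2 T1" "property_P2 T2" and lam: "0 \<le> lam" "lam \<le> 1"
    and T: "\<And>x. T x = geodesic_combination lam (T1 x) (T2 x)"
  shows "2 * dist (T u) (T v) \<le> dist u (T v) + dist (T u) v"
proof -
  define \<beta> where "\<beta> = pair_dist lam (T1 u, T2 u) (T1 v, T2 v)"
  define \<delta> where "\<delta> = dist (T u) (T v)"
  have \<beta>: "\<delta> \<le> \<beta>"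
    unfolding \<delta>_def \<beta>_def by (rule dist_average_le[OF P2 lam T])
  have "2 * \<beta>\<^sup>2 + 2 * \<delta>\<^sup>2 \<le> 2 * dist u (T v) * \<beta> + 2 * dist (T u) v * \<beta>"
    using pair_map_P2[OF lam P2, of u v] projection_P2[OF lam, of "(T1 u, T2 u)" "(T1 v, T2 v)"]
      pair_quadrilateral_inequality[OF lam, of "(u, u)" "(T1 v, T2 v)" "(T v, T v)" "(T1 u, T2 u)"]
      pair_quadrilateral_inequality[OF lam, of "(T u, T u)" "(T1 v, T2 v)" "(v, v)" "(T1 u, T2 u)"]
    by (simp add: T[symmetric] pair_dist_diagonal \<beta>_def \<delta>_def pair_dist_commute dist_commute)
  moreover have "2 * \<delta> * \<beta> \<le> \<beta>\<^sup>2 + \<delta>\<^sup>2"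
    using sum_squares_bound[of \<delta> \<beta>] by (simp add: add.commute)
  ultimately have "2 * \<delta> * \<beta> \<le> (dist u (T v) + dist (T u) v) * \<beta>"
    by (simp add: algebra_simps)
  moreover have "0 \<le> \<delta>"
    by (simp add: \<delta>_def)
  ultimately have "2 * \<delta> \<le> dist u (T v) + dist (T u) v"
    using \<beta> by (cases "\<beta> = 0") auto
  then show ?thesis
    by (simp add: \<delta>_def)
qed

section \<open>The rate for orbits in metric spaces\<close>

text \<open>The error \<open>2 ^ k - (k + 1)\<close> solves the recursion \<open>c (k + 1) = 2 * c k + k\<close> that arises when the
  distance over \<open>k + 2\<close> steps is estimated from below by those over \<open>k + 1\<close> and \<open>k\<close> steps, the latter
  being at most \<open>k * t\<close>.\<close>

lemma dist_ge_of_steady_steps: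
  fixes x :: "nat \<Rightarrow> 'a::metric_space"
  assumes mid: "\<And>i j. 2 * dist (x (Suc i)) (x (Suc j))
      \<le> dist (x i) (x (Suc j)) + dist (x (Suc i)) (x j)"
    and dec: "decseq (\<lambda>n. dist (x n) (x (Suc n)))"
    and "s \<le> dist (x (n + k)) (x (Suc (n + k)))" and "dist (x (Suc n)) (x (Suc (Suc n))) \<le> t"
  shows "(real k + 1) * s - (2 ^ k - (real k + 1)) * (t - s) \<le> dist (x n) (x (n + k + 1))"
  using assms(3,4)
proof (induction k arbitrary: n)
  case 0
  then show ?case by simp
next
  case (Suc k)
  have t': "dist (x (Suc (Suc n))) (x (Suc (Suc (Suc n)))) \<le> t"
    using decseqD[OF dec, of "Suc n" "Suc (Suc n)"] Suc.prems by simp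
  have short: "dist (x (Suc n)) (x (Suc n + i)) \<le> real i * t" for i
  proof (induction i)
    case (Suc i)
    have "dist (x (Suc n + i)) (x (Suc (Suc n + i))) \<le> t"
      using decseqD[OF dec, of "Suc n" "Suc n + i"] Suc.prems \<open>dist (x (Suc n)) _ \<le> t\<close> by simp
    then show ?case
      using Suc dist_triangle[of "x (Suc n)" "x (Suc (Suc n + i))" "x (Suc n + i)"]
      by (simp add: algebra_simps)
  qed simp
  have "(real k + 1) * s - (2 ^ k - (real k + 1)) * (t - s)
      \<le> dist (x (Suc n)) (x (Suc n + k + 1))"
    using Suc.prems t' by (intro Suc.IH) auto
  then have "2 * ((real k + 1) * s - (2 ^ k - (real k + 1)) * (t - s)) - real k * t
      \<le> dist (x n) (x (n + Suc k + 1))"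
    using mid[of n "Suc n + k"] short[of k] by simp
  then show ?case
    by (simp add: algebra_simps)
qed

lemma exists_small_drop:
  fixes f :: "nat \<Rightarrow> real"
  assumes "f 0 - f m < real m * \<delta>"
  shows "\<exists>i<m. f i - f (Suc i) < \<delta>"
proof (rule ccontr)
  assume "\<not> ?thesis"
  then have "(\<Sum>i<m. \<delta>) \<le> (\<Sum>i<m. f i - f (Suc i))"
    by (intro sum_mono) (meson lessThan_iff not_le)
  then show False
    using assms by (simp add: sum_lessThan_telescope')
qed

text \<open>A step longer than \<open>\<epsilon>\<close> after the last block would make all earlier steps longer than \<open>\<epsilon>\<close>. In
  a block where the step length drops by less than \<open>\<delta> = \<epsilon> / (1 + 2 ^ k)\<close>, the total error of
  \<open>dist_ge_of_steady_steps\<close> is at most \<open>\<epsilon>\<close>. Since \<open>k \<epsilon> \<ge> 2 b\<close> by the choice of \<open>k\<close>, the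
  \<open>k + 1\<close> steps then cover more than \<open>(k + 1) \<epsilon> - \<epsilon> \<ge> 2 b\<close>, which exceeds the diameter.\<close>

lemma step_le_of_Phi_rate:
  fixes x :: "nat \<Rightarrow> 'a::metric_space"
  assumes mid: "\<And>i j. 2 * dist (x (Suc i)) (x (Suc j))
      \<le> dist (x i) (x (Suc j)) + dist (x (Suc i)) (x j)"
    and dec: "decseq (\<lambda>n. dist (x n) (x (Suc n)))"
    and diam: "\<And>i j. dist (x i) (x j) \<le> 2 * b"
    and "0 < b" "0 < \<epsilon>" "Phi_rate b \<epsilon> \<le> n"
  shows "dist (x n) (x (Suc n)) \<le> \<epsilon>"
proof (rule ccontr)
  assume not_le: "\<not> ?thesis"
  define a where "a n = dist (x n) (x (Suc n))" for n
  define k where "k = k_rate b \<epsilon>"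
  define m where "m = nat \<lceil>2 * b * (1 + 2 ^ k) / \<epsilon>\<rceil>"
  define \<delta> where "\<delta> = \<epsilon> / (1 + 2 ^ k)"
  have pos: "(0::real) < 1 + 2 ^ k"
    by (simp add: add_pos_pos)
  have dec_a: "a j \<le> a i" if "i \<le> j" for i j
    using decseqD[OF dec that] by (simp add: a_def)
  have Phi: "Phi_rate b \<epsilon> = m * k + 1"
    by (simp add: Phi_rate_def k_def m_def)
  have large: "\<epsilon> < a (m * k + 1)"
    using not_le dec_a[OF \<open>Phi_rate b \<epsilon> \<le> n\<close>] unfolding Phi by (simp add: a_def)
  have k: "2 * b \<le> real k * \<epsilon>"
    using real_nat_ceiling_ge[of "2 * b / \<epsilon>"] \<open>0 < \<epsilon>\<close>
    by (simp add: k_def k_rate_def pos_divide_le_eq)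
  have m: "2 * b \<le> real m * \<delta>"
    using real_nat_ceiling_ge[of "2 * b * (1 + 2 ^ k) / \<epsilon>"] \<open>0 < \<epsilon>\<close> pos
    by (simp add: m_def \<delta>_def pos_divide_le_eq pos_le_divide_eq)
  have "a 1 \<le> 2 * b"
    unfolding a_def by (rule diam)
  then have "a (0 * k + 1) - a (m * k + 1) < real m * \<delta>"
    using m large \<open>0 < \<epsilon>\<close> by simp
  \<comment> \<open>The blocks start at index 1, as the distance covered from \<open>x (i * k)\<close> is controlled by the decrease
    of the step length after the first step.\<close>
  from exists_small_drop[of "\<lambda>i. a (i * k + 1)", OF this]
  obtain i where "i < m" and drop: "a (i * k + 1) - a (Suc i * k + 1) < \<delta>"
    by blast
  define s where "s = a (i * k + k)"
  define t where "t = a (Suc (i * k))"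
  have "a (m * k + 1) \<le> s"
    unfolding s_def using mult_le_mono1[of "Suc i" m k] \<open>i < m\<close>
    by (intro dec_a) (simp add: add.commute)
  then have s: "\<epsilon> < s"
    using large by simp
  have ts: "t - s < \<delta>"
    using drop dec_a[of "i * k + k" "Suc (i * k + k)"] by (simp add: s_def t_def add.commute)
  have "(real k + 1) * s - (2 ^ k - (real k + 1)) * (t - s) \<le> dist (x (i * k)) (x (i * k + k + 1))"
    using mid dec by (rule dist_ge_of_steady_steps) (simp_all add: s_def t_def a_def)
  then have "(real k + 1) * s - (2 ^ k - (real k + 1)) * (t - s) \<le> 2 * b"
    using diam order_trans by blast
  moreover have "(2 ^ k - (real k + 1)) * (t - s) \<le> \<epsilon>"
  proof -
    have "Suc k \<le> 2 ^ k"
      by (simp add: Suc_leI)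
    then have "real (Suc k) \<le> 2 ^ k"
      by (metis of_nat_le_iff of_nat_numeral of_nat_power)
    then have "(2 ^ k - (real k + 1)) * (t - s) \<le> (2 ^ k - (real k + 1)) * \<delta>"
      using ts by (intro mult_left_mono) auto
    also have "\<dots> \<le> (1 + 2 ^ k) * \<delta>"
      using \<open>0 < \<epsilon>\<close> pos by (intro mult_right_mono) (auto simp: \<delta>_def)
    also have "\<dots> = \<epsilon>"
      using pos by (simp add: \<delta>_def)
    finally show ?thesis .
  qed
  moreover have "(real k + 1) * \<epsilon> < (real k + 1) * s"
    using s by (intro mult_strict_left_mono) auto
  ultimately show False
    using k by (simp add: algebra_simps)
qed

theorem proposition3p2:
  fixes T1 T2 T :: "'a::cat0_space \<Rightarrow> 'a" and lam b :: real and p :: 'a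
  assumes "property_P2 T1" and "property_P2 T2"
    and "0 < lam" and "lam < 1"
    and "\<And>x. T x = geodesic_combination lam (T1 x) (T2 x)"
    and "p \<in> Fix T"
    and "b > 0"
  shows "\<forall>x. dist x p \<le> b \<longrightarrow>
           (\<forall>\<epsilon>>0. \<forall>n\<ge>Phi_rate b \<epsilon>. dist ((T ^^ n) x) ((T ^^ (n + 1)) x) \<le> \<epsilon>)"
proof (intro allI impI)
  fix x :: 'a and \<epsilon> :: real and n :: nat
  assume x: "dist x p \<le> b" and \<epsilon>: "0 < \<epsilon>" and n: "Phi_rate b \<epsilon> \<le> n"
  have lam: "0 \<le> lam" "lam \<le> 1"
    using assms(3,4) by simp_all
  have nonexp: "dist (T u) (T v) \<le> dist u v" for u v
    using dist_average_le[OF assms(1,2) lam assms(5), of u v] by simp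
  have p: "T p = p"
    using assms(6) by (simp add: Fix_def)
  define orb where "orb n = (T ^^ n) x" for n
  have orb_Suc: "orb (Suc n) = T (orb n)" for n
    by (simp add: orb_def)
  have near: "dist (orb n) p \<le> b" for n
  proof (induction n)
    case 0
    then show ?case using x by (simp add: orb_def)
  next
    case (Suc n)
    then show ?case using nonexp[of "orb n" p] by (simp add: orb_Suc p)
  qed
  have "dist (orb n) (orb (Suc n)) \<le> \<epsilon>"
  proof (rule step_le_of_Phi_rate[OF _ _ _ \<open>b > 0\<close> \<epsilon> n])
    show "2 * dist (orb (Suc i)) (orb (Suc j))
      \<le> dist (orb i) (orb (Suc j)) + dist (orb (Suc i)) (orb j)" for i j
      unfolding orb_Suc by (rule average_midpoint_bound[OF assms(1,2) lam assms(5)])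
    show "decseq (\<lambda>n. dist (orb n) (orb (Suc n)))"
      by (rule decseq_SucI) (simp add: orb_Suc nonexp)
    show "dist (orb i) (orb j) \<le> 2 * b" for i j
      using near[of i] near[of j] dist_triangle2[of "orb i" "orb j" p] by simp
  qed
  then show "dist ((T ^^ n) x) ((T ^^ (n + 1)) x) \<le> \<epsilon>"
    by (simp add: orb_def)
qed

end
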